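(* Let $G$ be a finite non-trivial abelian group with identity $e$, and let $\Delta$ be the digraph obtained from the directed endomorphism graph of $G$ by deleting the vertex $e$. Then $\Delta$ is diconnected if and only if $G\cong(\mathbb{Z}_p)^k$ for some prime $p$ and some $k\in\mathbb{N}$.
   Context: The directed endomorphism graph of a group $G$ has vertex set $G$, with an arc from $x$ to $y$ if $x\neq y$ and some endomorphism of $G$ maps $x$ to $y$. A digraph is diconnected if for every ordered pair of vertices $(u,v)$ there is a directed path from $u$ to $v$. $\mathbb{Z}_p$ is the additive group of integers modulo $p$, and $\mathbb{N}$ denotes the positive integers. *)

theory Defs
  imports
    "HOL-Algebra.Product_Groups"
    "HOL-Computational_Algebra.Primes"
    "Graph_Theory.Graph_Theory"
begin

text \<open>
  Arcs are ordered pairs of vertices. \<^term>\<open>hom G G\<close> consists of total HOL functions constrained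
  only on \<^term>\<open>carrier G\<close>; their values elsewhere are irrelevant here.
\<close>

definition dir_endo_graph :: "('a, 'b) monoid_scheme \<Rightarrow> ('a, 'a \<times> 'a) pre_digraph" where
  "dir_endo_graph G =
     \<lparr>verts = carrier G,
      arcs = {(x, y). x \<in> carrier G \<and> y \<in> carrier G \<and> x \<noteq> y \<and> (\<exists>f \<in> hom G G. f x = y)},
      tail = fst,
      head = snd\<rparr>"

text \<open>
  \<^const>\<open>pre_digraph.apath\<close> is a directed path without repeated vertices; for \<open>u = v\<close> the path of
  length zero qualifies. Unlike \<^const>\<open>strongly_connected\<close>, the null digraph is not excluded.
\<close>

definition diconnected :: "('a, 'b) pre_digraph \<Rightarrow> bool" where
  "diconnected D \<longleftrightarrow> (\<forall>u \<in> verts D. \<forall>v \<in> verts D. \<exists>p. pre_digraph.apath D u p v)"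

end

theory Submission
  imports Defs "HOL-Algebra.Multiplicative_Group" "HOL-Number_Theory.Cong"
begin

text \<open>
  Endomorphisms compose, so the existence of a directed path between two non-identity elements
  already gives an endomorphism carrying the first to the second: \<open>\<Delta>\<close> is diconnected exactly when
  any non-identity element can be mapped to any other one by an endomorphism
  (\<open>diconnected_iff_endo_transitive\<close>).

  Suppose this holds. A finite non-trivial group has an element \<open>u\<close> of prime order \<open>p\<close>. Every
  \<open>v \<noteq> \<one>\<close> is an image of \<open>u\<close> under a homomorphism, so \<open>v\<close> satisfies \<open>v\<^sup>p = \<one>\<close>; hence \<open>G\<close> is an
  abelian group of exponent \<open>p\<close> (\<open>endo_transitive_imp_prime_exponent\<close>). Such a group is a vector
  space over the field of order \<open>p\<close>, and the existence of a basis takes the following form: an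
  embedding of \<open>(\<int>\<^sub>p)\<^sup>k\<close> that misses some element \<open>a\<close> extends to an embedding of \<open>(\<int>\<^sub>p)\<^bsup>k+1\<^esup>\<close>
  sending the new coordinate vector to \<open>a\<close> (\<open>extend_embedding\<close>). Finiteness bounds \<open>k\<close>, and an
  embedding with \<open>k\<close> maximal is onto (\<open>prime_exponent_imp_iso_power\<close>).

  Conversely, in \<open>(\<int>\<^sub>p)\<^sup>k\<close> let \<open>u\<close> have a coordinate \<open>u\<^sub>i \<noteq> 0\<close>, and let \<open>c\<close> be an inverse of \<open>u\<^sub>i\<close>
  modulo \<open>p\<close>. Then \<open>w \<mapsto> (c w\<^sub>i) v\<close> is an endomorphism carrying \<open>u\<close> to \<open>v\<close>
  (\<open>endo_transitive_power\<close>), and this property is invariant under isomorphism.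
\<close>

section \<open>Diconnectedness as transitivity of endomorphisms\<close>

definition endo_transitive :: "('a, 'b) monoid_scheme \<Rightarrow> bool" where
  "endo_transitive G \<longleftrightarrow>
     (\<forall>u \<in> carrier G - {\<one>\<^bsub>G\<^esub>}. \<forall>v \<in> carrier G - {\<one>\<^bsub>G\<^esub>}. \<exists>f \<in> hom G G. f u = v)"

text \<open>
  Composing the endomorphisms attached to the arcs of a path turns the path into a single
  endomorphism.
\<close>

lemma endo_along_path:
  assumes "pre_digraph.cas (pre_digraph.del_vert (dir_endo_graph G) z) u p v"
    and "set p \<subseteq> arcs (pre_digraph.del_vert (dir_endo_graph G) z)"
  shows "\<exists>f \<in> hom G G. f u = v"
  using assms
proof (induction p arbitrary: u)
  case Nil
  have "(\<lambda>x. x) \<in> hom G G"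
    by (simp add: hom_def)
  with Nil show ?case
    by (auto simp: pre_digraph.cas.simps)
next
  case (Cons e es)
  from Cons.prems obtain f where f: "f \<in> hom G G" "f u = snd e"
    by (auto simp: pre_digraph.cas.simps pre_digraph.del_vert_simps dir_endo_graph_def)
  moreover from Cons obtain g where g: "g \<in> hom G G" "g (snd e) = v"
    by (auto simp: pre_digraph.cas.simps pre_digraph.del_vert_simps dir_endo_graph_def)
  ultimately have "g \<circ> f \<in> hom G G" "(g \<circ> f) u = v"
    using Group.hom_compose by auto
  then show ?case
    by blast
qed

lemma diconnected_iff_endo_transitive:
  "diconnected (pre_digraph.del_vert (dir_endo_graph G) \<one>\<^bsub>G\<^esub>) \<longleftrightarrow> endo_transitive G"
  (is "diconnected ?D \<longleftrightarrow> _")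
proof
  assume connected: "diconnected ?D"
  show "endo_transitive G"
    unfolding endo_transitive_def
  proof (intro ballI)
    fix u v
    assume "u \<in> carrier G - {\<one>\<^bsub>G\<^esub>}" "v \<in> carrier G - {\<one>\<^bsub>G\<^esub>}"
    then have "u \<in> verts ?D" "v \<in> verts ?D"
      by (simp_all add: pre_digraph.del_vert_simps dir_endo_graph_def)
    then obtain p where "pre_digraph.apath ?D u p v"
      using connected unfolding diconnected_def by blast
    then have "pre_digraph.cas ?D u p v" "set p \<subseteq> arcs ?D"
      by (simp_all add: pre_digraph.apath_def pre_digraph.awalk_def)
    then show "\<exists>f \<in> hom G G. f u = v"
      by (rule endo_along_path)
  qed
next
  assume trans: "endo_transitive G"
  have "\<exists>p. pre_digraph.apath ?D u p v" if uv: "u \<in> verts ?D" "v \<in> verts ?D" for u v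
  proof (cases "u = v")
    case True
    then have "pre_digraph.apath ?D u [] v"
      using uv by (simp add: pre_digraph.apath_def pre_digraph.awalk_def pre_digraph.cas.simps
          pre_digraph.awalk_verts.simps)
    then show ?thesis ..
  next
    case False
    have "u \<in> carrier G - {\<one>\<^bsub>G\<^esub>}" "v \<in> carrier G - {\<one>\<^bsub>G\<^esub>}"
      using uv by (auto simp: pre_digraph.del_vert_simps dir_endo_graph_def)
    with trans False have "(u, v) \<in> arcs ?D"
      by (auto simp: endo_transitive_def pre_digraph.del_vert_simps dir_endo_graph_def)
    moreover have "tail ?D (u, v) = u" "head ?D (u, v) = v"
      by (simp_all add: pre_digraph.del_vert_simps dir_endo_graph_def)
    ultimately have "pre_digraph.apath ?D u [(u, v)] v"
      using uv False by (simp add: pre_digraph.apath_def pre_digraph.awalk_def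
          pre_digraph.cas.simps pre_digraph.awalk_verts.simps)
    then show ?thesis ..
  qed
  then show "diconnected ?D"
    by (simp add: diconnected_def)
qed

section \<open>Transitivity forces prime exponent\<close>

text \<open>
  Any \<open>x \<noteq> \<one>\<close> has an order divisible by some prime \<open>p\<close>, and its power with exponent \<open>ord x div p\<close>
  has order \<open>p\<close>.
\<close>

lemma (in group) exists_prime_order_element:
  assumes "finite (carrier G)" and "\<not> trivial_group G"
  shows "\<exists>p u. prime p \<and> u \<in> carrier G \<and> ord u = p"
proof -
  obtain x where x: "x \<in> carrier G" "x \<noteq> \<one>"
    using assms(2) is_group one_closed by (auto simp: trivial_group_def)
  then have "ord x \<noteq> 1"
    using ord_eq_1 by blast
  then obtain p where p: "prime p" "p dvd ord x"
    using prime_factor_nat by blast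
  have pos: "ord x > 0"
    using ord_ge_1[OF assms(1) x(1)] by simp
  have "ord x div p dvd ord x" "ord x div p \<noteq> 0"
    using p pos by (auto simp: dvd_div_eq_0_iff)
  then have "ord (x [^] (ord x div p)) = ord x div (ord x div p)"
    using ord_pow x(1) by blast
  also have "\<dots> = p"
  proof -
    have "ord x = p * (ord x div p)"
      using p(2) by simp
    then show ?thesis
      using \<open>ord x div p \<noteq> 0\<close> by (metis nonzero_mult_div_cancel_right)
  qed
  finally show ?thesis
    using p x(1) by blast
qed

lemma (in group) endo_transitive_imp_prime_exponent:
  assumes "finite (carrier G)" and "\<not> trivial_group G" and "endo_transitive G"
  shows "\<exists>p::nat. prime p \<and> (\<forall>x \<in> carrier G. x [^] p = \<one>)"
proof -
  obtain p u where p: "prime p" and u: "u \<in> carrier G" "ord u = p"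
    using exists_prime_order_element assms by blast
  have "u \<noteq> \<one>"
    using p u ord_id by auto
  have "v [^] p = \<one>" if v: "v \<in> carrier G" for v
  proof (cases "v = \<one>")
    case False
    then obtain f where f: "f \<in> hom G G" "f u = v"
      using assms(3) u(1) \<open>u \<noteq> \<one>\<close> v unfolding endo_transitive_def by blast
    interpret f: group_hom G G f
      by unfold_locales (rule f(1))
    have "v [^] p = f (u [^] ord u)"
      using f.hom_nat_pow[OF u(1), of p] f(2) u(2) by simp
    then show ?thesis
      using u(1) by simp
  qed simp
  then show ?thesis
    using p by (intro exI[of _ p]) simp
qed

section \<open>Elementary abelian groups are powers of a cyclic group\<close>

lemma inverse_mod_prime:
  fixes x :: int
  assumes "prime p" and "0 < x" and "x < int p"
  shows "\<exists>c. (c * x) mod int p = 1"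
proof -
  have "\<not> int p dvd x"
    using assms zdvd_not_zless by blast
  then have "coprime x (int p)"
    using assms(1) prime_imp_coprime[of "int p" x] by (simp add: coprime_commute)
  then obtain c where "[x * c = 1] (mod int p)"
    using cong_solve_coprime_int by blast
  moreover have "int p > 1"
    using assms(1) prime_gt_1_nat by fastforce
  ultimately have "(c * x) mod int p = 1"
    by (simp add: cong_def mult.commute)
  then show ?thesis ..
qed

abbreviation power_Z :: "nat \<Rightarrow> nat \<Rightarrow> (nat \<Rightarrow> int) monoid" where
  "power_Z p k \<equiv> product_group {..<k} (\<lambda>_. integer_mod_group p)"

lemma carrier_power_Z:
  "prime p \<Longrightarrow> carrier (power_Z p k) = ({..<k} \<rightarrow>\<^sub>E {0..<int p})"
  by (auto simp: carrier_integer_mod_group)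

lemma group_power_Z: "group (power_Z p k)"
  by simp

text \<open>
  The extension is \<open>w \<mapsto> \<phi>(w\<^sub>0, \<dots>, w\<^bsub>k-1\<^esub>) \<otimes> a\<^bsup>w\<^sub>k\<^esup>\<close>. It is well defined because \<open>a\<^sup>p = \<one>\<close>, and it
  is injective because \<open>a\<^bsup>w\<^sub>k\<^esup>\<close> can lie in the image of \<open>\<phi>\<close> only for \<open>w\<^sub>k = 0\<close>: otherwise \<open>w\<^sub>k\<close> is
  invertible modulo \<open>p\<close>, and \<open>a\<close> itself would lie in that image.
\<close>

lemma (in comm_group) extend_embedding:
  assumes p: "prime p" and exponent: "\<And>x. x \<in> carrier G \<Longrightarrow> x [^] p = \<one>"
    and hom: "\<phi> \<in> hom (power_Z p k) G" and inj: "inj_on \<phi> (carrier (power_Z p k))"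
    and a: "a \<in> carrier G" and outside: "a \<notin> \<phi> ` carrier (power_Z p k)"
  shows "\<exists>\<psi> \<in> hom (power_Z p (Suc k)) G. inj_on \<psi> (carrier (power_Z p (Suc k)))"
proof -
  let ?r = "\<lambda>w :: nat \<Rightarrow> int. restrict w {..<k}"
  define \<psi> where "\<psi> w = \<phi> (?r w) \<otimes> a [^] (w k)" for w
  interpret \<phi>: group_hom "power_Z p k" G \<phi>
    using hom by (simp add: group_hom_def group_hom_axioms_def)
  have ord_dvd: "int (ord a) dvd int p"
    using exponent[OF a] pow_eq_id[OF a] by simp
  have pow_mod: "a [^] (m mod int p) = a [^] m" for m :: int
  proof -
    have "int p dvd m - m mod int p"
      by (rule dvd_minus_mod)
    then show ?thesis
      using int_pow_eq[OF a] ord_dvd dvd_trans by blast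
  qed
  have r: "?r w \<in> carrier (power_Z p k)" if "w \<in> carrier (power_Z p (Suc k))" for w
    using that by (auto simp: PiE_iff)
  have \<psi>_hom: "\<psi> \<in> hom (power_Z p (Suc k)) G"
  proof (rule homI)
    fix w assume "w \<in> carrier (power_Z p (Suc k))"
    then show "\<psi> w \<in> carrier G"
      using r a \<phi>.hom_closed unfolding \<psi>_def by (intro m_closed int_pow_closed) blast+
  next
    fix w z assume w: "w \<in> carrier (power_Z p (Suc k))" and z: "z \<in> carrier (power_Z p (Suc k))"
    have *: "?r (w \<otimes>\<^bsub>power_Z p (Suc k)\<^esub> z) = ?r w \<otimes>\<^bsub>power_Z p k\<^esub> ?r z"
      by (auto simp: restrict_def fun_eq_iff)
    have "a [^] ((w \<otimes>\<^bsub>power_Z p (Suc k)\<^esub> z) k) = a [^] w k \<otimes> a [^] z k"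
      by (simp add: pow_mod int_pow_mult a)
    moreover have "\<phi> (?r (w \<otimes>\<^bsub>power_Z p (Suc k)\<^esub> z)) = \<phi> (?r w) \<otimes> \<phi> (?r z)"
      unfolding * using \<phi>.hom_mult[OF r[OF w] r[OF z]] .
    ultimately show "\<psi> (w \<otimes>\<^bsub>power_Z p (Suc k)\<^esub> z) = \<psi> w \<otimes> \<psi> z"
      using \<phi>.hom_closed[OF r[OF w]] \<phi>.hom_closed[OF r[OF z]] a int_pow_closed[OF a]
      unfolding \<psi>_def by (simp only: m_ac m_closed)
  qed
  interpret \<psi>: group_hom "power_Z p (Suc k)" G \<psi>
    using \<psi>_hom by (simp add: group_hom_def group_hom_axioms_def)
  have "w = \<one>\<^bsub>power_Z p (Suc k)\<^esub>"
    if w: "w \<in> carrier (power_Z p (Suc k))" and one: "\<psi> w = \<one>" for w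
  proof (cases "w k = 0")
    case True
    then have "\<phi> (?r w) = \<one>"
      using one \<phi>.hom_closed[OF r[OF w]] by (simp add: \<psi>_def)
    then have "?r w = \<one>\<^bsub>power_Z p k\<^esub>"
      using \<phi>.inj_on_one_iff inj r[OF w] by blast
    then have "w i = 0" if "i < k" for i
      using that by (auto simp: fun_eq_iff restrict_def split: if_splits)
    with True have "w i = 0" if "i < Suc k" for i
      using that less_Suc_eq by auto
    with w show ?thesis
      by (auto simp: fun_eq_iff PiE_iff extensional_def)
  next
    case False
    have "w k \<in> {0..<int p}"
      using w unfolding carrier_power_Z[OF p] by (auto simp: PiE_iff)
    with False obtain c where c: "(c * w k) mod int p = 1"
      using inverse_mod_prime[OF p, of "w k"] by auto
    let ?H = "\<phi> ` carrier (power_Z p k)"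
    have H: "subgroup ?H G"
      by (rule \<phi>.img_is_subgroup)
    have "a [^] w k = inv (\<phi> (?r w))"
      using one \<phi>.hom_closed[OF r[OF w]] a unfolding \<psi>_def
      by (metis int_pow_closed inv_equality inv_inv)
    then have "a [^] w k \<in> ?H"
      using subgroup.m_inv_closed[OF H] r[OF w] by simp
    then have "(a [^] w k) [^] c \<in> ?H"
      using subgroup_int_pow_closed[OF H] by blast
    moreover have "(a [^] w k) [^] c = a"
      using pow_mod[of "c * w k"] c a by (simp add: int_pow_pow mult.commute)
    ultimately show ?thesis
      using outside by simp
  qed
  then have "inj_on \<psi> (carrier (power_Z p (Suc k)))"
    using \<psi>.inj_on_one_iff by blast
  with \<psi>_hom show ?thesis
    by blast
qed

text \<open>
  The embeddings of \<open>(\<int>\<^sub>p)\<^sup>k\<close> into \<open>G\<close> have bounded rank because \<open>k < 2\<^sup>k \<le> p\<^sup>k\<close>, and one of maximal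
  rank is onto by the extension lemma.
\<close>

lemma (in comm_group) prime_exponent_imp_iso_power:
  assumes fin: "finite (carrier G)" and nontriv: "\<not> trivial_group G"
    and p: "prime p" and exponent: "\<And>x. x \<in> carrier G \<Longrightarrow> x [^] p = \<one>"
  shows "\<exists>k \<ge> 1. G \<cong> power_Z p k"
proof -
  define emb where "emb k \<longleftrightarrow> (\<exists>\<phi> \<in> hom (power_Z p k) G. inj_on \<phi> (carrier (power_Z p k)))" for k
  have "(\<lambda>_. \<one>) \<in> hom (power_Z p 0) G"
    by (simp add: hom_def)
  then have "emb 0"
    unfolding emb_def by (intro bexI) auto
  have bound: "k \<le> card (carrier G)" if k: "emb k" for k
  proof -
    obtain \<phi> where \<phi>: "\<phi> \<in> hom (power_Z p k) G" "inj_on \<phi> (carrier (power_Z p k))"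
      using k unfolding emb_def by blast
    have "k < 2 ^ k"
      by (rule less_exp)
    also have "\<dots> \<le> p ^ k"
      using p prime_ge_2_nat power_mono by blast
    also have "p ^ k = card (carrier (power_Z p k))"
      unfolding carrier_power_Z[OF p] by (simp add: card_PiE)
    also have "\<dots> \<le> card (carrier G)"
      using \<phi> fin by (intro card_inj_on_le[of \<phi>]) (auto simp: hom_def)
    finally show ?thesis
      by simp
  qed
  define k where "k = (GREATEST k. emb k)"
  have "emb k"
    unfolding k_def using \<open>emb 0\<close> bound by (rule GreatestI_nat)
  then obtain \<phi> where \<phi>: "\<phi> \<in> hom (power_Z p k) G" "inj_on \<phi> (carrier (power_Z p k))"
    unfolding emb_def by blast
  have "\<not> emb (Suc k)"
  proof
    assume "emb (Suc k)"
    then have "Suc k \<le> k"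
      unfolding k_def using bound by (rule Greatest_le_nat)
    then show False
      by simp
  qed
  then have "carrier G \<subseteq> \<phi> ` carrier (power_Z p k)"
    using extend_embedding[OF p exponent \<phi>] unfolding emb_def by blast
  then have onto: "\<phi> ` carrier (power_Z p k) = carrier G"
    using \<phi>(1) by (auto simp: hom_def)
  have "\<phi> \<in> iso (power_Z p k) G"
    using \<phi> onto by (simp add: iso_iff)
  then have "G \<cong> power_Z p k"
    using group.iso_sym[OF group_power_Z] is_iso_def by blast
  moreover have "k \<noteq> 0"
  proof
    assume "k = 0"
    then have "carrier G = {\<phi> (\<lambda>_. undefined)}"
      using onto by simp
    then have "carrier G = {\<one>}"
      using one_closed by auto
    with nontriv is_group show False
      by (simp add: trivial_group_def)
  qed
  ultimately show ?thesis
    by (intro exI[of _ k]) simp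
qed

section \<open>Powers of a cyclic group of prime order are transitive\<close>

text \<open>
  Projecting to a coordinate in which \<open>u\<close> does not vanish, rescaling that coordinate of \<open>u\<close> to \<open>1\<close>,
  and multiplying \<open>v\<close> by the result is a homomorphism carrying \<open>u\<close> to \<open>v\<close>.
\<close>

lemma endo_transitive_power:
  assumes p: "prime p"
  shows "endo_transitive (power_Z p k)"
  unfolding endo_transitive_def
proof (intro ballI)
  fix u v
  assume u: "u \<in> carrier (power_Z p k) - {\<one>\<^bsub>power_Z p k\<^esub>}"
    and "v \<in> carrier (power_Z p k) - {\<one>\<^bsub>power_Z p k\<^esub>}"
  then have v: "v \<in> {..<k} \<rightarrow>\<^sub>E {0..<int p}"
    using carrier_power_Z[OF p] by blast
  have uc: "u \<in> {..<k} \<rightarrow>\<^sub>E {0..<int p}"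
    using u carrier_power_Z[OF p] by blast
  have "\<exists>i<k. u i \<noteq> 0"
  proof (rule ccontr)
    assume "\<not> ?thesis"
    with uc have "u = \<one>\<^bsub>power_Z p k\<^esub>"
      by (auto simp: fun_eq_iff PiE_iff extensional_def)
    with u show False
      by simp
  qed
  then obtain i where i: "i < k" "u i \<noteq> 0"
    by blast
  with uc have "0 < u i" "u i < int p"
    by (auto simp: PiE_iff order_less_le)
  then obtain c where c: "(c * u i) mod int p = 1"
    using inverse_mod_prime[OF p] by blast
  define f where "f w = (\<lambda>j\<in>{..<k}. (c * w i * v j) mod int p)" for w :: "nat \<Rightarrow> int"
  have pos: "int p > 0"
    using p prime_gt_0_nat by simp
  have "f \<in> hom (power_Z p k) (power_Z p k)"
  proof (rule homI)
    fix w
    show "f w \<in> carrier (power_Z p k)"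
      unfolding carrier_power_Z[OF p] f_def using pos by auto
  next
    fix w z
    have "(c * ((w i + z i) mod int p) * v j) mod int p
        = ((c * w i * v j) mod int p + (c * z i * v j) mod int p) mod int p" for j
    proof -
      have "(c * ((w i + z i) mod int p) * v j) mod int p = (c * (w i + z i) * v j) mod int p"
        by (metis mod_mult_left_eq mod_mult_right_eq)
      then show ?thesis
        by (simp add: mod_simps algebra_simps)
    qed
    then show "f (w \<otimes>\<^bsub>power_Z p k\<^esub> z) = f w \<otimes>\<^bsub>power_Z p k\<^esub> f z"
      using i by (auto simp: f_def fun_eq_iff)
  qed
  moreover have "f u = v"
  proof
    fix j
    show "f u j = v j"
    proof (cases "j < k")
      case True
      have "(c * u i * v j) mod int p = ((c * u i) mod int p * v j) mod int p"
        by (simp add: mod_simps)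
      also have "\<dots> = v j"
        using v True c by (auto simp: PiE_iff)
      finally show ?thesis
        using True by (simp add: f_def)
    next
      case False
      with v show ?thesis
        by (simp add: f_def PiE_iff extensional_def)
    qed
  qed
  ultimately show "\<exists>f \<in> hom (power_Z p k) (power_Z p k). f u = v"
    by blast
qed

lemma endo_transitive_iso:
  assumes "group G" and "group H" and "G \<cong> H" and trans: "endo_transitive H"
  shows "endo_transitive G"
  unfolding endo_transitive_def
proof (intro ballI)
  fix u v
  assume u: "u \<in> carrier G - {\<one>\<^bsub>G\<^esub>}" and v: "v \<in> carrier G - {\<one>\<^bsub>G\<^esub>}"
  obtain h where h: "h \<in> iso G H"
    using assms(3) by (auto simp: is_iso_def)
  interpret h: group_hom G H h
    using assms(1,2) h by (simp add: group_hom_def group_hom_axioms_def iso_def)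
  have inj: "inj_on h (carrier G)"
    using h by (simp add: iso_iff)
  have "h u \<in> carrier H - {\<one>\<^bsub>H\<^esub>}" "h v \<in> carrier H - {\<one>\<^bsub>H\<^esub>}"
    using u v inj h.inj_on_one_iff by auto
  then obtain f where f: "f \<in> hom H H" "f (h u) = h v"
    using trans unfolding endo_transitive_def by blast
  let ?h' = "inv_into (carrier G) h"
  have "?h' \<in> hom H G"
    using group.iso_set_sym[OF assms(1) h] by (simp add: iso_def)
  then have "?h' \<circ> (f \<circ> h) \<in> hom G G"
    using Group.hom_compose[OF Group.hom_compose[OF h.homh f(1)]] by blast
  moreover have "(?h' \<circ> (f \<circ> h)) u = v"
    using f(2) v inj by simp
  ultimately show "\<exists>f \<in> hom G G. f u = v"
    by blast
qed

section \<open>Groups with diconnected endomorphism graph\<close>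

theorem theorem7p2:
  fixes G :: "('a, 'b) monoid_scheme"
  assumes "comm_group G"
    and "finite (carrier G)"
    and "\<not> trivial_group G"
  shows "diconnected (pre_digraph.del_vert (dir_endo_graph G) \<one>\<^bsub>G\<^esub>) \<longleftrightarrow>
    (\<exists>p k :: nat. prime p \<and> k \<ge> 1 \<and> G \<cong> product_group {..<k} (\<lambda>_. integer_mod_group p))"
proof -
  interpret comm_group G
    by fact
  show ?thesis
    unfolding diconnected_iff_endo_transitive
  proof
    assume "endo_transitive G"
    then obtain p :: nat where p: "prime p" "\<forall>x \<in> carrier G. x [^]\<^bsub>G\<^esub> p = \<one>\<^bsub>G\<^esub>"
      using endo_transitive_imp_prime_exponent assms(2,3) by blast
    then have "\<exists>k \<ge> 1. G \<cong> power_Z p k"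
      using prime_exponent_imp_iso_power assms(2,3) by blast
    with p(1) show "\<exists>p k. prime p \<and> k \<ge> 1 \<and> G \<cong> power_Z p k"
      by blast
  next
    assume "\<exists>p k. prime p \<and> k \<ge> 1 \<and> G \<cong> power_Z p k"
    then show "endo_transitive G"
      using endo_transitive_iso[OF is_group group_power_Z] endo_transitive_power by blast
  qed
qed

end
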